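(* There are uniform constants $C,c_0>0$ such that the solutions $\widehat V=\widehat V(\xi,t)\in\mathbb C^3$ of the linear system $$\widehat V_t+\big(i\xi\widetilde A(\xi)+\xi^2\widetilde B\big)\widehat V=0$$ (with $\widetilde A,\widetilde B$ as in the context) satisfy the pointwise estimate $$|\widehat V(\xi,t)|\le C\exp(-c_0\xi^2t)\,|\widehat V(\xi,0)|$$ for all $\xi\in\mathbb R$, $t\ge0$.
   Context: $\overline\rho,\overline\theta,\overline p_\rho,\overline p_\theta,\overline e_\theta,\overline\mu,\overline\alpha,\overline k>0$ and $\overline u\in\mathbb R$ are constants (a constant state $(\overline\rho,\overline u,\overline\theta)$ and the values at it of derivatives of the pressure $p$ and internal energy $e$, the viscosity, heat conductivity and capillarity). Set $\beta(\xi):=\overline p_\rho+\xi^2\,\overline k\,\overline\rho$, $\ \overline c:=\overline p_\theta\,\overline\theta^{1/2}/(\overline e_\theta^{1/2}\,\overline\rho)>0$, $$\widetilde A(\xi)=\begin{pmatrix}\overline u&\beta(\xi)^{1/2}&0\\\beta(\xi)^{1/2}&\overline u&\overline c\\0&\overline c&\overline u\end{pmatrix},\qquad \widetilde B=\begin{pmatrix}0&0&0\\0&\overline\mu/\overline\rho&0\\0&0&\overline\alpha/(\overline e_\theta\overline\rho)\end{pmatrix}.$$ *)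

theory Defs
  imports "HOL-Analysis.Analysis"
begin

text \<open>The real arguments are the values at the constant state (overlined quantities);
  \<open>p\<^sub>\<rho>\<close>, \<open>p\<^sub>\<theta>\<close>, \<open>e\<^sub>\<theta>\<close> are the partial derivatives of pressure and internal energy there,
  \<open>\<mu>\<close> is the viscosity, \<open>\<alpha>\<close> the heat conductivity and \<open>k\<close> the capillarity.\<close>

definition beta_sym :: "real \<Rightarrow> real \<Rightarrow> real \<Rightarrow> real \<Rightarrow> real" where
  "beta_sym \<rho> p\<^sub>\<rho> k \<xi> = p\<^sub>\<rho> + \<xi>\<^sup>2 * k * \<rho>"

definition c_bar :: "real \<Rightarrow> real \<Rightarrow> real \<Rightarrow> real \<Rightarrow> real" where
  "c_bar \<rho> \<theta> p\<^sub>\<theta> e\<^sub>\<theta> = p\<^sub>\<theta> * sqrt \<theta> / (sqrt e\<^sub>\<theta> * \<rho>)"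

definition A_tilde ::
  "real \<Rightarrow> real \<Rightarrow> real \<Rightarrow> real \<Rightarrow> real \<Rightarrow> real \<Rightarrow> real \<Rightarrow> real \<Rightarrow> real^3^3" where
  "A_tilde \<rho> u \<theta> p\<^sub>\<rho> p\<^sub>\<theta> e\<^sub>\<theta> k \<xi> =
     (let b = sqrt (beta_sym \<rho> p\<^sub>\<rho> k \<xi>); c = c_bar \<rho> \<theta> p\<^sub>\<theta> e\<^sub>\<theta>
      in vector [vector [u, b, 0],
                 vector [b, u, c],
                 vector [0, c, u]])"

definition B_tilde :: "real \<Rightarrow> real \<Rightarrow> real \<Rightarrow> real \<Rightarrow> real^3^3" where
  "B_tilde \<rho> e\<^sub>\<theta> \<mu> \<alpha> =
     vector [vector [0, 0, 0],
             vector [0, \<mu> / \<rho>, 0],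
             vector [0, 0, \<alpha> / (e\<^sub>\<theta> * \<rho>)]]"

definition fourier_symbol :: "real \<Rightarrow> real^3^3 \<Rightarrow> real^3^3 \<Rightarrow> complex^3^3" where
  "fourier_symbol \<xi> A B =
     (\<chi> i j. \<i> * complex_of_real \<xi> * complex_of_real (A $ i $ j)
            + complex_of_real (\<xi>\<^sup>2) * complex_of_real (B $ i $ j))"

text \<open>The derivative is one-sided at \<open>t = 0\<close>; nothing is required of \<open>V\<close> for \<open>t < 0\<close>.\<close>

definition solves_linear_system :: "complex^3^3 \<Rightarrow> (real \<Rightarrow> complex^3) \<Rightarrow> bool" where
  "solves_linear_system M V \<longleftrightarrow>
     (\<forall>t\<ge>0. \<exists>V'. (V has_vector_derivative V') (at t within {0..}) \<and> V' + M *v V t = 0)"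

end

theory Submission imports Defs begin

text \<open>Write \<open>V = (a, v, w)\<close> and \<open>b = sqrt \<beta>(\<xi>)\<close>.  Since \<open>\<xi> A\<close> is real symmetric, the energy
  \<open>|V|\<^sup>2/2\<close> decays at rate \<open>\<xi>\<^sup>2\<close> in the components \<open>v\<close> and \<open>w\<close>, but \<open>B\<close> does not see \<open>a\<close>.
  The missing dissipation comes from the coupling of \<open>a\<close> and \<open>v\<close>: the functional
  \<open>|V|\<^sup>2/2 - \<delta> (\<xi>/b) Im (a v\<^sup>*)\<close> produces \<open>-\<delta> \<xi>\<^sup>2 |a|\<^sup>2\<close> upon differentiation.  Because \<open>b\<close> grows like
  \<open>|\<xi>|\<close> (capillarity) and is bounded below (\<open>p\<^sub>\<rho> > 0\<close>), the factors \<open>\<xi>/b\<close> and \<open>1/b\<close> are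
  bounded, so for small \<open>\<delta>\<close> all remaining terms are absorbed uniformly in \<open>\<xi>\<close>.  Below,
  \<open>Im (a v\<^sup>*)\<close> is written as the real inner product \<open>a \<bullet> (\<i> * v)\<close>.\<close>

text \<open>The integrating factor \<open>exp (l * s)\<close> turns the inequality into a
  nonpositive derivative of \<open>g\<close>. The mean value theorem is applied on
  \<open>{0..t}\<close> with derivatives within that interval, so a one-sided derivative at 0
  suffices.\<close>

lemma gronwall_decay:
  fixes f :: "real \<Rightarrow> real"
  assumes der: "\<And>t. t \<ge> 0 \<Longrightarrow> (f has_real_derivative f' t) (at t within {0..})"
    and le: "\<And>t. t \<ge> 0 \<Longrightarrow> f' t \<le> - l * f t"
    and "t \<ge> 0"
  shows "f t \<le> exp (- l * t) * f 0"
proof -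
  define g where "g = (\<lambda>s. exp (l * s) * f s)"
  have g': "(g has_derivative (*) (exp (l * s) * (f' s + l * f s))) (at s within {0..t})"
    if "0 \<le> s" for s
  proof -
    have "(g has_real_derivative exp (l * s) * (f' s + l * f s)) (at s within {0..})"
      unfolding g_def
      by (rule derivative_eq_intros der[OF that] refl)+ (simp add: algebra_simps)
    then show ?thesis
      using has_derivative_subset[of _ _ s "{0..}" "{0..t}"]
      by (auto simp: has_field_derivative_def)
  qed
  obtain s where s: "s \<in> {0..t}"
    and eq: "g t - g 0 = exp (l * s) * (f' s + l * f s) * (t - 0)"
    using mvt_very_simple[of 0 t g "\<lambda>s. (*) (exp (l * s) * (f' s + l * f s))"] g' \<open>t \<ge> 0\<close>
    by auto
  have "g t - g 0 \<le> 0"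
    unfolding eq using le[of s] s \<open>t \<ge> 0\<close>
    by (intro mult_nonpos_nonneg mult_nonneg_nonpos) auto
  then have "exp (- l * t) * g t \<le> exp (- l * t) * f 0"
    by (simp add: g_def)
  moreover have "exp (- l * t) * g t = f t"
    by (simp add: g_def mult.assoc[symmetric] exp_add[symmetric])
  ultimately show ?thesis by metis
qed

lemma norm_power2_vec3:
  fixes x :: "'a::real_normed_vector ^ 3"
  shows "(norm x)\<^sup>2 = (norm (x $ 1))\<^sup>2 + (norm (x $ 2))\<^sup>2 + (norm (x $ 3))\<^sup>2"
  by (simp add: norm_vec_def L2_set_def sum_3)

lemma fourier_symbol_mult_vec:
  "fourier_symbol \<xi> A B *v x =
     (\<chi> i. \<Sum>j\<in>UNIV. (\<i> * of_real \<xi> * of_real (A $ i $ j)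
                       + of_real (\<xi>\<^sup>2) * of_real (B $ i $ j)) * x $ j)"
  by (simp add: fourier_symbol_def matrix_vector_mult_def)

lemma abs_mult_le_quarter_add:
  fixes x y K :: real
  shows "\<bar>K * (x * y)\<bar> \<le> x\<^sup>2 / 4 + K\<^sup>2 * y\<^sup>2"
proof -
  have "0 \<le> (\<bar>x\<bar> / 2 - \<bar>K * y\<bar>)\<^sup>2" by simp
  then show ?thesis
    by (simp add: power2_diff power_divide power_mult_distrib abs_mult mult_ac)
qed

text \<open>Cauchy-Schwarz followed by Young's inequality. The weight 1/4 lets two such terms
  together cost only half of the squared norm of \<open>x\<close>.\<close>

lemma abs_scaled_inner_le:
  fixes x y :: "'a::real_inner"
  assumes "\<bar>q\<bar> \<le> K"
  shows "\<bar>q * (x \<bullet> y)\<bar> \<le> (norm x)\<^sup>2 / 4 + K\<^sup>2 * (norm y)\<^sup>2"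
proof -
  have "\<bar>q * (x \<bullet> y)\<bar> \<le> K * (norm x * norm y)"
    unfolding abs_mult using assms by (intro mult_mono Cauchy_Schwarz_ineq2) auto
  then show ?thesis
    using abs_mult_le_quarter_add[of K "norm x" "norm y"] by linarith
qed

text \<open>The weight \<open>d\<close> will be \<open>\<delta> * r\<close> with
  \<open>r = \<xi> / b\<close>, so it depends on the frequency.\<close>

definition lyapunov :: "real \<Rightarrow> complex^3 \<Rightarrow> real" where
  "lyapunov d x = (norm x)\<^sup>2 / 2 - d * (x $ 1 \<bullet> (\<i> * x $ 2))"

text \<open>The cross term is at most a quarter of the squared norm, which makes the functional
  equivalent to the squared norm with constants independent of \<open>d\<close>, hence of
  \<xi>.\<close>

lemma lyapunov_bounds:
  assumes "\<bar>d\<bar> \<le> 1 / 2"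
  shows "(norm x)\<^sup>2 / 4 \<le> lyapunov d x" "lyapunov d x \<le> 3 * (norm x)\<^sup>2 / 4"
proof -
  have "\<bar>d * (x $ 1 \<bullet> (\<i> * x $ 2))\<bar> \<le> (norm (x $ 1))\<^sup>2 / 4 + (1/2)\<^sup>2 * (norm (\<i> * x $ 2))\<^sup>2"
    by (rule abs_scaled_inner_le[OF assms])
  also have "\<dots> \<le> (norm x)\<^sup>2 / 4"
    by (simp add: norm_power2_vec3 norm_mult power_divide)
  finally have "\<bar>d * (x $ 1 \<bullet> (\<i> * x $ 2))\<bar> \<le> (norm x)\<^sup>2 / 4" .
  then show "(norm x)\<^sup>2 / 4 \<le> lyapunov d x" "lyapunov d x \<le> 3 * (norm x)\<^sup>2 / 4"
    unfolding lyapunov_def by linarith+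
qed

lemma lyapunov_has_derivative:
  assumes "(V has_vector_derivative V') (at t within S)"
  shows "((\<lambda>t. lyapunov d (V t)) has_real_derivative
           (\<Sum>j\<in>UNIV. V t $ j \<bullet> V' $ j)
           - d * (V' $ 1 \<bullet> (\<i> * V t $ 2) + V t $ 1 \<bullet> (\<i> * V' $ 2))) (at t within S)"
proof -
  have comp: "((\<lambda>t. V t $ j) has_vector_derivative V' $ j) (at t within S)" for j
    using bounded_linear.has_vector_derivative[OF bounded_linear_vec_nth assms] .
  have inn: "((\<lambda>t. f t \<bullet> g t) has_real_derivative f t \<bullet> g' + f' \<bullet> g t) (at t within S)"
    if "(f has_vector_derivative f') (at t within S)" "(g has_vector_derivative g') (at t within S)"
    for f g :: "real \<Rightarrow> complex" and f' g'
    using bounded_bilinear.has_vector_derivative[OF bounded_bilinear_inner that]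
    by (simp add: has_real_derivative_iff_has_vector_derivative)
  have rot: "((\<lambda>t. \<i> * V t $ 2) has_vector_derivative \<i> * V' $ 2) (at t within S)"
    using has_vector_derivative_mult_right[OF comp] .
  have eq: "lyapunov d (V t) = 1 / 2 * (V t $ 1 \<bullet> V t $ 1 + V t $ 2 \<bullet> V t $ 2 + V t $ 3 \<bullet> V t $ 3)
      - d * (V t $ 1 \<bullet> (\<i> * V t $ 2))" for t
    by (simp add: lyapunov_def norm_power2_vec3 power2_norm_eq_inner)
  show ?thesis
    unfolding eq
    by (rule DERIV_cong, rule DERIV_diff[OF DERIV_cmult DERIV_cmult], (rule DERIV_add inn comp rot)+)
       (simp add: sum_3 inner_commute algebra_simps)
qed

text \<open>Pointwise algebra at one frequency and time: \<open>x'\<close> is minus the symbol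
  applied to \<open>x\<close>, in coordinates. The quotients \<open>\<xi> / b\<close> and
  \<open>c / b\<close> enter as \<open>r\<close> and \<open>q\<close>.\<close>

context
  fixes \<xi> u b c m n r q :: real and x x' :: "complex^3"
  assumes rb: "r * b = \<xi>" and qr: "r * c = \<xi> * q"
    and x1: "x' $ 1 = - \<i> * \<xi> * (u * x $ 1 + b * x $ 2)"
    and x2: "x' $ 2 = - \<i> * \<xi> * (b * x $ 1 + u * x $ 2 + c * x $ 3) - \<xi>\<^sup>2 * m * x $ 2"
    and x3: "x' $ 3 = - \<i> * \<xi> * (c * x $ 2 + u * x $ 3) - \<xi>\<^sup>2 * n * x $ 3"
begin

text \<open>The first-order part is skew-Hermitian and drops out of the real inner product; only the
  diagonal damping survives.\<close>

lemma energy_dissipation: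
  "(\<Sum>j\<in>UNIV. x $ j \<bullet> x' $ j) = - \<xi>\<^sup>2 * (m * (norm (x $ 2))\<^sup>2 + n * (norm (x $ 3))\<^sup>2)"
  by (simp add: sum_3 x1 x2 x3 inner_complex_def cmod_power2) algebra

text \<open>The transport terms in \<open>u\<close> rotate both components alike and cancel. The
  coupling \<open>b\<close> yields the difference of squares, and the factor \<open>r\<close> turns
  \<open>\<xi> * b\<close> into \<xi>^2, the same scale as the damping.\<close>

lemma cross_term_derivative:
  "r * (x' $ 1 \<bullet> (\<i> * x $ 2) + x $ 1 \<bullet> (\<i> * x' $ 2)) =
     \<xi>\<^sup>2 * ((norm (x $ 1))\<^sup>2 - (norm (x $ 2))\<^sup>2 + q * (x $ 1 \<bullet> x $ 3)
       - m * r * (x $ 1 \<bullet> (\<i> * x $ 2)))"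
proof -
  have "x' $ 1 \<bullet> (\<i> * x $ 2) + x $ 1 \<bullet> (\<i> * x' $ 2) =
      \<xi> * (b * ((norm (x $ 1))\<^sup>2 - (norm (x $ 2))\<^sup>2) + c * (x $ 1 \<bullet> x $ 3)
        - m * \<xi> * (x $ 1 \<bullet> (\<i> * x $ 2)))"
    by (simp add: x1 x2 inner_complex_def cmod_power2) algebra
  then have "r * (x' $ 1 \<bullet> (\<i> * x $ 2) + x $ 1 \<bullet> (\<i> * x' $ 2)) =
      \<xi> * (r * b * ((norm (x $ 1))\<^sup>2 - (norm (x $ 2))\<^sup>2) + r * c * (x $ 1 \<bullet> x $ 3)
        - m * \<xi> * r * (x $ 1 \<bullet> (\<i> * x $ 2)))"
    by (simp only:) (simp add: algebra_simps)
  also have "\<dots> = \<xi>\<^sup>2 * ((norm (x $ 1))\<^sup>2 - (norm (x $ 2))\<^sup>2 + q * (x $ 1 \<bullet> x $ 3)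
       - m * r * (x $ 1 \<bullet> (\<i> * x $ 2)))"
    unfolding rb qr by (simp add: power2_eq_square[of \<xi>] algebra_simps)
  finally show ?thesis .
qed

text \<open>Of the gain \<open>\<delta> * a\<close>, half pays for the two indefinite terms
  \<open>X\<close> and \<open>Y\<close>. The damping \<open>m\<close> must cover the loss
  \<open>\<delta> * v\<close>, the share R^2 from \<open>Y\<close> and a remainder 1/2, hence 3/2;
  \<open>n\<close> covers the share Q^2 from \<open>X\<close> and the remainder 1/2.\<close>

lemma lyapunov_dissipation:
  assumes "0 < \<delta>" and "\<bar>q\<bar> \<le> Q" and "\<bar>m * r\<bar> \<le> R"
    and m: "\<delta> * (3 / 2 + R\<^sup>2) \<le> m" and n: "\<delta> * (1 / 2 + Q\<^sup>2) \<le> n"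
  shows "(\<Sum>j\<in>UNIV. x $ j \<bullet> x' $ j)
     - \<delta> * r * (x' $ 1 \<bullet> (\<i> * x $ 2) + x $ 1 \<bullet> (\<i> * x' $ 2)) \<le> - (\<delta> / 2 * \<xi>\<^sup>2) * (norm x)\<^sup>2"
proof -
  define a v w where "a = (norm (x $ 1))\<^sup>2" and "v = (norm (x $ 2))\<^sup>2" and "w = (norm (x $ 3))\<^sup>2"
  define X Y where "X = q * (x $ 1 \<bullet> x $ 3)" and "Y = m * r * (x $ 1 \<bullet> (\<i> * x $ 2))"
  have "\<bar>X\<bar> \<le> a / 4 + Q\<^sup>2 * w" "\<bar>Y\<bar> \<le> a / 4 + R\<^sup>2 * v"
    using abs_scaled_inner_le[OF assms(2), of "x $ 1" "x $ 3"]
      abs_scaled_inner_le[OF assms(3), of "x $ 1" "\<i> * x $ 2"]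
    by (auto simp: X_def Y_def a_def v_def w_def norm_mult)
  then have "\<delta> * (Y - X) \<le> \<delta> * (a / 2 + Q\<^sup>2 * w + R\<^sup>2 * v)"
    using \<open>0 < \<delta>\<close> by (intro mult_left_mono) auto
  moreover have "\<delta> * (3 / 2 + R\<^sup>2) * v \<le> m * v" "\<delta> * (1 / 2 + Q\<^sup>2) * w \<le> n * w"
    by (intro mult_right_mono m n; simp add: v_def w_def)+
  ultimately have "- (m * v + n * w) - \<delta> * (a - v + X - Y) \<le> - (\<delta> / 2) * (a + v + w)"
    unfolding distrib_left distrib_right right_diff_distrib by linarith
  then have "\<xi>\<^sup>2 * (- (m * v + n * w) - \<delta> * (a - v + X - Y)) \<le> \<xi>\<^sup>2 * (- (\<delta> / 2) * (a + v + w))"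
    by (rule mult_left_mono) simp
  then show ?thesis
    unfolding mult.assoc[of \<delta>] cross_term_derivative energy_dissipation norm_power2_vec3[of x]
      X_def[symmetric] Y_def[symmetric] a_def[symmetric] v_def[symmetric] w_def[symmetric]
    by (simp add: algebra_simps)
qed

end

theorem lemma4p14:
  fixes \<rho> u \<theta> p\<^sub>\<rho> p\<^sub>\<theta> e\<^sub>\<theta> \<mu> \<alpha> k :: real
  assumes "\<rho> > 0" and "\<theta> > 0" and "p\<^sub>\<rho> > 0" and "p\<^sub>\<theta> > 0" and "e\<^sub>\<theta> > 0"
    and "\<mu> > 0" and "\<alpha> > 0" and "k > 0"
  shows "\<exists>C>0. \<exists>c\<^sub>0>0. \<forall>V :: real \<Rightarrow> real \<Rightarrow> complex^3.
    (\<forall>\<xi>. solves_linear_system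
            (fourier_symbol \<xi> (A_tilde \<rho> u \<theta> p\<^sub>\<rho> p\<^sub>\<theta> e\<^sub>\<theta> k \<xi>) (B_tilde \<rho> e\<^sub>\<theta> \<mu> \<alpha>)) (V \<xi>)) \<longrightarrow>
    (\<forall>\<xi>. \<forall>t\<ge>0. norm (V \<xi> t) \<le> C * exp (- c\<^sub>0 * \<xi>\<^sup>2 * t) * norm (V \<xi> 0))"
proof -
  define m n c where "m = \<mu> / \<rho>" and "n = \<alpha> / (e\<^sub>\<theta> * \<rho>)" and "c = c_bar \<rho> \<theta> p\<^sub>\<theta> e\<^sub>\<theta>"
  have "0 < m" "0 < n" using assms by (auto simp: m_def n_def)
  \<comment> \<open>Bounds, uniform in \<xi>, for \<open>\<bar>\<xi> / b\<bar>\<close> and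
    \<open>\<bar>c / b\<bar>\<close>.\<close>
  define R Q where "R = 1 / sqrt (k * \<rho>)" and "Q = \<bar>c\<bar> / sqrt p\<^sub>\<rho>"
  have "0 \<le> R" "0 \<le> Q" using assms by (auto simp: R_def Q_def)
  \<comment> \<open>\<open>K\<close> dominates every factor that \<delta> has to control: those of
    \<open>m\<close> and \<open>n\<close> in the dissipation estimate, and \<open>2 * R\<close>,
    which keeps the weight \<open>\<delta> * r\<close> within 1/2.\<close>
  define K where "K = 3 / 2 + (m * R)\<^sup>2 + Q\<^sup>2 + 2 * R"
  have "0 < K" using \<open>0 \<le> R\<close> by (simp add: K_def add_pos_nonneg)
  define \<delta> where "\<delta> = min m (min n 1) / K"
  have "0 < \<delta>" using \<open>0 < m\<close> \<open>0 < n\<close> \<open>0 < K\<close> by (simp add: \<delta>_def)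
  have \<delta>K: "\<delta> * L \<le> m" "\<delta> * L \<le> n" "\<delta> * L \<le> 1" if "L \<le> K" for L
  proof -
    have "\<delta> * L \<le> \<delta> * K" using that \<open>0 < \<delta>\<close> by simp
    also have "\<dots> = min m (min n 1)" using \<open>0 < K\<close> by (simp add: \<delta>_def)
    finally show "\<delta> * L \<le> m" "\<delta> * L \<le> n" "\<delta> * L \<le> 1" by auto
  qed
  have bound: "norm (V t) \<le> 2 * exp (- (\<delta> / 4) * \<xi>\<^sup>2 * t) * norm (V 0)"
    if sol: "solves_linear_system
          (fourier_symbol \<xi> (A_tilde \<rho> u \<theta> p\<^sub>\<rho> p\<^sub>\<theta> e\<^sub>\<theta> k \<xi>) (B_tilde \<rho> e\<^sub>\<theta> \<mu> \<alpha>)) V"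
      and "t \<ge> 0" for \<xi> t :: real and V :: "real \<Rightarrow> complex^3"
  proof -
    define M where "M = fourier_symbol \<xi> (A_tilde \<rho> u \<theta> p\<^sub>\<rho> p\<^sub>\<theta> e\<^sub>\<theta> k \<xi>) (B_tilde \<rho> e\<^sub>\<theta> \<mu> \<alpha>)"
    define b where "b = sqrt (beta_sym \<rho> p\<^sub>\<rho> k \<xi>)"
    define V' where "V' s = - (M *v V s)" for s
    have der: "(V has_vector_derivative V' s) (at s within {0..})" if "s \<ge> 0" for s
      using sol that unfolding solves_linear_system_def M_def[symmetric] V'_def
      by (metis add_eq_0_iff2)
    have V': "V' s $ 1 = - \<i> * \<xi> * (u * V s $ 1 + b * V s $ 2)"
        "V' s $ 2 = - \<i> * \<xi> * (b * V s $ 1 + u * V s $ 2 + c * V s $ 3) - \<xi>\<^sup>2 * m * V s $ 2"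
        "V' s $ 3 = - \<i> * \<xi> * (c * V s $ 2 + u * V s $ 3) - \<xi>\<^sup>2 * n * V s $ 3" for s
      by (simp_all add: V'_def M_def fourier_symbol_mult_vec sum_3 A_tilde_def B_tilde_def
          Let_def b_def c_def m_def n_def algebra_simps)
    \<comment> \<open>Each bound keeps one of the two nonnegative summands of \<beta>: the pressure
      part for low frequencies, the capillary part for high ones.\<close>
    have b: "sqrt p\<^sub>\<rho> \<le> b" "\<bar>\<xi>\<bar> * sqrt (k * \<rho>) \<le> b"
    proof -
      show "sqrt p\<^sub>\<rho> \<le> b" using assms by (simp add: b_def beta_sym_def)
      have "sqrt (\<xi>\<^sup>2 * (k * \<rho>)) \<le> b" using assms by (simp add: b_def beta_sym_def mult.assoc)
      then show "\<bar>\<xi>\<bar> * sqrt (k * \<rho>) \<le> b" by (simp add: real_sqrt_mult)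
    qed
    have "0 < b" using b(1) assms by (smt (verit) real_sqrt_gt_zero)
    define r q where "r = \<xi> / b" and "q = c / b"
    have rq: "r * b = \<xi>" "r * c = \<xi> * q" using \<open>0 < b\<close> by (auto simp: r_def q_def)
    have r: "\<bar>r\<bar> \<le> R" using b(2) \<open>0 < b\<close> assms by (simp add: r_def R_def field_simps)
    have q: "\<bar>q\<bar> \<le> Q" using b(1) \<open>0 < b\<close> assms by (simp add: q_def Q_def frac_le)
    have mr: "\<bar>m * r\<bar> \<le> m * R" using r \<open>0 < m\<close> by (simp add: abs_mult)
    have "\<delta> * (2 * R) \<le> 1" by (rule \<delta>K) (simp add: K_def)
    moreover have "\<bar>\<delta> * r\<bar> \<le> \<delta> * R" using r \<open>0 < \<delta>\<close> by (simp add: abs_mult)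
    ultimately have \<delta>r: "\<bar>\<delta> * r\<bar> \<le> 1 / 2" by linarith
    define F where "F s = lyapunov (\<delta> * r) (V s)" for s
    have F: "(norm (V s))\<^sup>2 / 4 \<le> F s" "F s \<le> 3 * (norm (V s))\<^sup>2 / 4" for s
      unfolding F_def by (rule lyapunov_bounds[OF \<delta>r])+
    \<comment> \<open>This turns dissipation of the squared norm into a closed differential
      inequality for \<open>F\<close>.\<close>
    have F': "F s \<le> (norm (V s))\<^sup>2" for s
      using F(2)[of s] zero_le_power2[of "norm (V s)"] by linarith
    have "F t \<le> exp (- (\<delta> / 2 * \<xi>\<^sup>2) * t) * F 0"
    proof (rule gronwall_decay[OF _ _ \<open>t \<ge> 0\<close>])
      fix s :: real assume "s \<ge> 0"
      show "(F has_real_derivative (\<Sum>j\<in>UNIV. V s $ j \<bullet> V' s $ j)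
          - \<delta> * r * (V' s $ 1 \<bullet> (\<i> * V s $ 2) + V s $ 1 \<bullet> (\<i> * V' s $ 2))) (at s within {0..})"
        unfolding F_def by (rule lyapunov_has_derivative[OF der[OF \<open>s \<ge> 0\<close>]])
      have "(\<Sum>j\<in>UNIV. V s $ j \<bullet> V' s $ j)
          - \<delta> * r * (V' s $ 1 \<bullet> (\<i> * V s $ 2) + V s $ 1 \<bullet> (\<i> * V' s $ 2))
        \<le> - (\<delta> / 2 * \<xi>\<^sup>2) * (norm (V s))\<^sup>2"
        by (rule lyapunov_dissipation[OF rq V' \<open>0 < \<delta>\<close> q mr])
           (rule \<delta>K; use \<open>0 \<le> R\<close> in \<open>simp add: K_def\<close>)+
      also have "\<dots> \<le> - (\<delta> / 2 * \<xi>\<^sup>2) * F s"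
        using F'[of s] \<open>0 < \<delta>\<close> by (intro mult_left_mono_neg) auto
      finally show "(\<Sum>j\<in>UNIV. V s $ j \<bullet> V' s $ j)
          - \<delta> * r * (V' s $ 1 \<bullet> (\<i> * V s $ 2) + V s $ 1 \<bullet> (\<i> * V' s $ 2))
        \<le> - (\<delta> / 2 * \<xi>\<^sup>2) * F s" .
    qed
    also have "\<dots> \<le> exp (- (\<delta> / 2 * \<xi>\<^sup>2) * t) * (norm (V 0))\<^sup>2"
      using F' by (intro mult_left_mono) auto
    \<comment> \<open>The factor 4 undoes the lower bound on \<open>F\<close>. Taking square roots
      leaves the constant 2 and halves the rate to \<open>\<delta> / 4\<close>.\<close>
    finally have "(norm (V t))\<^sup>2 \<le> 4 * (exp (- (\<delta> / 2 * \<xi>\<^sup>2) * t) * (norm (V 0))\<^sup>2)"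
      using F(1)[of t] by linarith
    also have "\<dots> = (2 * exp (- (\<delta> / 4) * \<xi>\<^sup>2 * t) * norm (V 0))\<^sup>2"
      by (simp add: power_mult_distrib exp_double[symmetric])
    finally show ?thesis
      by (rule power2_le_imp_le) simp
  qed
  show ?thesis
    using \<open>0 < \<delta>\<close> bound by (intro exI[of _ "2::real"] exI[of _ "\<delta> / 4"] conjI allI impI) auto
qed

end
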